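(* Let $c\in\{1,-1\}$, let $f\colon M^n\to\mathbb{Q}^n_c\times\mathbb{R}$ be a hypersurface having $T$ as a principal direction and all of whose principal curvatures have constant multiplicity, and let $\lambda_i$, $i\in\{1,\dots,n\}$, be its principal curvatures, with $\lambda_n$ the one associated to $T$. If $f_t$ is the family of hypersurfaces parallel to $f$, with principal curvatures $\lambda_i^t$, $i\in\{1,\dots,n\}$, then $$\lambda_i^t=\frac{c\|T\|S_c(\|T\|t)+\lambda_i C_c(\|T\|t)}{C_c(\|T\|t)-\lambda_i\|T\|^{-1}S_c(\|T\|t)},\quad i\neq n,\qquad\text{and}\qquad \lambda_n^t=\frac{\lambda_n}{1-t\lambda_n}.$$
   Context: $\mathbb{Q}^n_c$ denotes the unit sphere $\mathbb{S}^n$ if $c=1$ and the hyperbolic space $\mathbb{H}^n$ (curvature $-1$) if $c=-1$. Let $\mathbb{E}^{n+2}$ be $\mathbb{R}^{n+2}$ with the flat metric $c\,dx_1^2+dx_2^2+\dots+dx_{n+2}^2$; then $\mathbb{Q}^n_c=\{x\in\mathbb{E}^{n+1}: cx_1^2+x_2^2+\dots+x_{n+1}^2=c\}$ (with $x_1>0$ if $c=-1$), $\mathbb{E}^{n+1}=\{x_{n+2}=0\}$, and $\mathbb{Q}^n_c\times\mathbb{R}\subset\mathbb{E}^{n+2}$, with projections $\pi_1,\pi_2$ onto the two factors. A hypersurface $f\colon M^n\to\mathbb{Q}^n_c\times\mathbb{R}$ is an isometric immersion of a Riemannian $n$-manifold with unit normal field $\eta$ and shape operator $A$ (so $\widetilde\nabla_X\eta=-df(AX)$);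 principal curvatures are the eigenvalues of $A$. With $\partial/\partial t$ the unit vector field tangent to the factor $\mathbb{R}$, the tangent vector field $T$ on $M^n$ and the smooth function $\nu$ are defined by $\partial/\partial t=df(T)+\nu\eta$. "$T$ is a principal direction" means that $T$ is nowhere zero and is at every point an eigenvector of $A$. $\{X_1,\dots,X_n\}$ is a local orthonormal frame of principal directions with $X_n=\|T\|^{-1}T$ and $AX_i=\lambda_iX_i$. $C_1=\cos$, $S_1=\sin$, $C_{-1}=\cosh$, $S_{-1}=\sinh$. Let $\xi\circ f=(\pi_1\circ f,0)$ and $\eta_{\mathbb{Q}}=\eta-\nu\,\partial/\partial t$ (so $\|\eta_{\mathbb{Q}}\|=\|T\|\ne0$). The hypersurfaces parallel to $f$ are $$f_t=C_c(\|T\|t)\,\xi\circ f+S_c(\|T\|t)\|T\|^{-1}\eta_{\mathbb{Q}}+(\pi_2\circ f+t\nu)\,\partial/\partial t,$$ that is $f_t(p)=\exp_{f(p)}(t\eta(p))$, considered where $f_t$ is an immersion, i.e. where $C_c(\|T\|t)-\lambda_i\|T\|^{-1}S_c(\|T\|t)\neq0$ for $i\le n-1$ and $1-t\lambda_n\neq0$. The principal curvatures $\lambda_i^t$ of $f_t$ (associated to the direction $X_i$) are taken with respect to the unit normal $\eta_t=-c\|T\|S_c(\|T\|t)\,\xi\circ f+C_c(\|T\|t)\,\eta_{\mathbb{Q}}+\nu\,\partial/\partial t$. *)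

theory Defs
  imports "HOL-Analysis.Analysis"
begin

section \<open>Smooth manifolds\<close>

text \<open>Continuous differentiability of order \<open>k\<close> on an open set, through iterated directional
  derivatives.\<close>

fun Ck_on :: "nat \<Rightarrow> ('a::euclidean_space \<Rightarrow> 'b::real_normed_vector) \<Rightarrow> 'a set \<Rightarrow> bool" where
  "Ck_on 0 f S \<longleftrightarrow> continuous_on S f"
| "Ck_on (Suc k) f S \<longleftrightarrow> (\<forall>x\<in>S. f differentiable (at x)) \<and>
     (\<forall>v. Ck_on k (\<lambda>x. frechet_derivative f (at x) v) S)"

definition smooth_on :: "('a::euclidean_space \<Rightarrow> 'b::real_normed_vector) \<Rightarrow> 'a set \<Rightarrow> bool" where
  "smooth_on f S \<longleftrightarrow> (\<forall>k. Ck_on k f S)"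

text \<open>A chart is a pair of a domain \<open>U\<close> and a map \<open>\<phi>\<close>, whose values outside \<open>U\<close> are irrelevant.
  The manifold is the whole type \<open>'m\<close>; its dimension is \<open>CARD('n)\<close>.\<close>

type_synonym ('m, 'n) chart = "'m set \<times> ('m \<Rightarrow> real^'n)"
type_synonym ('m, 'n) atlas = "('m, 'n) chart set"

definition smooth_atlas ::
    "('m::{t2_space,second_countable_topology}, 'n::finite) atlas \<Rightarrow> bool" where
  "smooth_atlas \<A> \<longleftrightarrow>
     (\<forall>p. \<exists>(U, \<phi>)\<in>\<A>. p \<in> U) \<and>
     (\<forall>(U, \<phi>)\<in>\<A>. open U \<and> open (\<phi> ` U) \<and> homeomorphism U (\<phi> ` U) \<phi> (inv_into U \<phi>)) \<and>
     (\<forall>(U, \<phi>)\<in>\<A>. \<forall>(W, \<psi>)\<in>\<A>. smooth_on (\<psi> \<circ> inv_into U \<phi>) (\<phi> ` (U \<inter> W)))"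

definition smooth_map_on ::
    "('m::topological_space, 'n::finite) atlas \<Rightarrow> 'm set \<Rightarrow> ('m \<Rightarrow> 'b::real_normed_vector) \<Rightarrow> bool" where
  "smooth_map_on \<A> V h \<longleftrightarrow> (\<forall>(U, \<phi>)\<in>\<A>. smooth_on (h \<circ> inv_into U \<phi>) (\<phi> ` (U \<inter> V)))"

text \<open>At every point one chart of the atlas is selected once and for all, and a tangent vector at
  \<open>p\<close> is given by its coordinates in the chart selected at \<open>p\<close>. Thus every tangent space is
  a copy of \<open>real^'n\<close>, but the copies at nearby points may come from different charts, so that
  smoothness of a vector field has to be tested after a change of coordinates.\<close>

definition chart_at :: "('m, 'n::finite) atlas \<Rightarrow> 'm \<Rightarrow> ('m, 'n) chart" where
  "chart_at \<A> p = (SOME ch. ch \<in> \<A> \<and> p \<in> fst ch)"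

definition differential ::
    "('m, 'n::finite) atlas \<Rightarrow> ('m \<Rightarrow> 'b::real_normed_vector) \<Rightarrow> 'm \<Rightarrow> real^'n \<Rightarrow> 'b" where
  "differential \<A> h p =
     (case chart_at \<A> p of (U, \<phi>) \<Rightarrow> frechet_derivative (h \<circ> inv_into U \<phi>) (at (\<phi> p)))"

text \<open>The vector \<open>differential \<A> \<phi> p (X p)\<close> below is the coordinate vector of \<open>X p\<close> in the
  chart \<open>\<phi>\<close>.\<close>

definition smooth_vector_field_on ::
    "('m::topological_space, 'n::finite) atlas \<Rightarrow> 'm set \<Rightarrow> ('m \<Rightarrow> real^'n) \<Rightarrow> bool" where
  "smooth_vector_field_on \<A> V X \<longleftrightarrow>
     (\<forall>(U, \<phi>)\<in>\<A>. smooth_map_on \<A> (U \<inter> V) (\<lambda>p. differential \<A> \<phi> p (X p)))"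

definition riemannian_metric ::
    "('m::topological_space, 'n::finite) atlas \<Rightarrow> ('m \<Rightarrow> real^'n \<Rightarrow> real^'n \<Rightarrow> real) \<Rightarrow> bool" where
  "riemannian_metric \<A> g \<longleftrightarrow>
     (\<forall>p. bilinear (g p) \<and> (\<forall>v w. g p v w = g p w v) \<and> (\<forall>v. v \<noteq> 0 \<longrightarrow> g p v v > 0)) \<and>
     (\<forall>V X Y. open V \<and> smooth_vector_field_on \<A> V X \<and> smooth_vector_field_on \<A> V Y \<longrightarrow>
        smooth_map_on \<A> V (\<lambda>p. g p (X p) (Y p)))"

definition rnorm :: "('m \<Rightarrow> real^'n \<Rightarrow> real^'n \<Rightarrow> real) \<Rightarrow> 'm \<Rightarrow> real^'n \<Rightarrow> real" where
  "rnorm g p v = sqrt (g p v v)"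

section \<open>The ambient space\<close>

text \<open>A point \<open>(x\<^sub>1, y, s)\<close> stands for \<open>x\<^sub>1\<close>, \<open>y = (x\<^sub>2, \<dots>, x\<^bsub>n+1\<^esub>)\<close> and \<open>s = x\<^bsub>n+2\<^esub>\<close>. The real
  parameter \<open>c\<close> is always \<open>1\<close> or \<open>-1\<close>.\<close>

type_synonym 'n ambient = "real \<times> (real^'n) \<times> real"

definition flat :: "real \<Rightarrow> 'n::finite ambient \<Rightarrow> 'n ambient \<Rightarrow> real" where
  "flat c = (\<lambda>(x, y, s) (x', y', s'). c * x * x' + y \<bullet> y' + s * s')"

definition QxR :: "real \<Rightarrow> 'n::finite ambient set" where
  "QxR c = {(x, y, s). c * x\<^sup>2 + y \<bullet> y = c \<and> (c = -1 \<longrightarrow> x > 0)}"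

definition ddt :: "'n::finite ambient" where
  "ddt = (0, 0, 1)"

text \<open>The vector \<open>\<xi> z\<close> spans the normal space of \<open>QxR c\<close> at \<open>z\<close>, and
  \<open>flat c (\<xi> z) (\<xi> z) = c\<close>.\<close>

definition \<xi> :: "'n::finite ambient \<Rightarrow> 'n ambient" where
  "\<xi> = (\<lambda>(x, y, s). (x, y, 0))"

definition height :: "'n::finite ambient \<Rightarrow> real" where
  "height = (\<lambda>(x, y, s). s)"

definition C :: "real \<Rightarrow> real \<Rightarrow> real" where
  "C c u = (if c = 1 then cos u else cosh u)"

definition S :: "real \<Rightarrow> real \<Rightarrow> real" where
  "S c u = (if c = 1 then sin u else sinh u)"

section \<open>Hypersurfaces\<close>

definition immersed_at ::
    "('m, 'n::finite) atlas \<Rightarrow> ('m \<Rightarrow> 'n ambient) \<Rightarrow> 'm \<Rightarrow> bool" where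
  "immersed_at \<A> f p \<longleftrightarrow> inj (differential \<A> f p)"

definition isometric_immersion ::
    "('m::topological_space, 'n::finite) atlas \<Rightarrow> ('m \<Rightarrow> real^'n \<Rightarrow> real^'n \<Rightarrow> real) \<Rightarrow> real \<Rightarrow>
     ('m \<Rightarrow> 'n ambient) \<Rightarrow> bool" where
  "isometric_immersion \<A> g c f \<longleftrightarrow>
     smooth_map_on \<A> UNIV f \<and> (\<forall>p. f p \<in> QxR c) \<and> (\<forall>p. immersed_at \<A> f p) \<and>
     (\<forall>p v w. flat c (differential \<A> f p v) (differential \<A> f p w) = g p v w)"

text \<open>The second conjunct in the scope of \<open>p\<close> says that \<open>\<eta> p\<close> is tangent to \<open>QxR c\<close>.\<close>

definition unit_normal_field ::
    "('m::topological_space, 'n::finite) atlas \<Rightarrow> real \<Rightarrow> ('m \<Rightarrow> 'n ambient) \<Rightarrow>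
     ('m \<Rightarrow> 'n ambient) \<Rightarrow> bool" where
  "unit_normal_field \<A> c f \<eta> \<longleftrightarrow>
     smooth_map_on \<A> UNIV \<eta> \<and>
     (\<forall>p. flat c (\<eta> p) (\<eta> p) = 1 \<and> flat c (\<eta> p) (\<xi> (f p)) = 0 \<and>
          (\<forall>v. flat c (differential \<A> f p v) (\<eta> p) = 0))"

text \<open>The Levi-Civita connection of \<open>QxR c\<close>, applied to a vector field \<open>Y\<close> along \<open>f\<close>, is the
  component tangent to \<open>QxR c\<close> of the derivative in the flat ambient space (Gauss formula).\<close>

definition covariant_derivative ::
    "('m, 'n::finite) atlas \<Rightarrow> real \<Rightarrow> ('m \<Rightarrow> 'n ambient) \<Rightarrow> ('m \<Rightarrow> 'n ambient) \<Rightarrow>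
     'm \<Rightarrow> real^'n \<Rightarrow> 'n ambient" where
  "covariant_derivative \<A> c f Y p v =
     differential \<A> Y p v - (c * flat c (differential \<A> Y p v) (\<xi> (f p))) *\<^sub>R \<xi> (f p)"

text \<open>The vector described is unique where \<open>f\<close> is an immersion, and exists if \<open>\<eta>\<close> is a unit
  normal field of \<open>f\<close>.\<close>

definition shape_operator ::
    "('m, 'n::finite) atlas \<Rightarrow> real \<Rightarrow> ('m \<Rightarrow> 'n ambient) \<Rightarrow> ('m \<Rightarrow> 'n ambient) \<Rightarrow>
     'm \<Rightarrow> real^'n \<Rightarrow> real^'n" where
  "shape_operator \<A> c f \<eta> p v =
     (THE w. covariant_derivative \<A> c f \<eta> p v = - differential \<A> f p w)"

definition principal_curvature_along ::
    "('m, 'n::finite) atlas \<Rightarrow> real \<Rightarrow> ('m \<Rightarrow> 'n ambient) \<Rightarrow> ('m \<Rightarrow> 'n ambient) \<Rightarrow>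
     'm \<Rightarrow> real^'n \<Rightarrow> real \<Rightarrow> bool" where
  "principal_curvature_along \<A> c f \<eta> p v l \<longleftrightarrow> v \<noteq> 0 \<and> shape_operator \<A> c f \<eta> p v = l *\<^sub>R v"

definition principal_direction ::
    "('m, 'n::finite) atlas \<Rightarrow> real \<Rightarrow> ('m \<Rightarrow> 'n ambient) \<Rightarrow> ('m \<Rightarrow> 'n ambient) \<Rightarrow>
     ('m \<Rightarrow> real^'n) \<Rightarrow> bool" where
  "principal_direction \<A> c f \<eta> T \<longleftrightarrow> (\<forall>p. \<exists>l. principal_curvature_along \<A> c f \<eta> p (T p) l)"

text \<open>The equation \<open>\<partial>/\<partial>t = df(T) + \<nu>\<eta>\<close>, which determines \<open>T\<close> and \<open>\<nu>\<close>.\<close>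

definition ddt_decomposition ::
    "('m, 'n::finite) atlas \<Rightarrow> ('m \<Rightarrow> 'n ambient) \<Rightarrow> ('m \<Rightarrow> 'n ambient) \<Rightarrow>
     ('m \<Rightarrow> real^'n) \<Rightarrow> ('m \<Rightarrow> real) \<Rightarrow> bool" where
  "ddt_decomposition \<A> f \<eta> T \<nu> \<longleftrightarrow> (\<forall>p. ddt = differential \<A> f p (T p) + \<nu> p *\<^sub>R \<eta> p)"

definition adapted_principal_basis ::
    "('m, 'n::finite) atlas \<Rightarrow> ('m \<Rightarrow> real^'n \<Rightarrow> real^'n \<Rightarrow> real) \<Rightarrow> real \<Rightarrow>
     ('m \<Rightarrow> 'n ambient) \<Rightarrow> ('m \<Rightarrow> 'n ambient) \<Rightarrow> ('m \<Rightarrow> real^'n) \<Rightarrow> (nat \<Rightarrow> 'm \<Rightarrow> real) \<Rightarrow>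
     'm \<Rightarrow> (nat \<Rightarrow> real^'n) \<Rightarrow> bool" where
  "adapted_principal_basis \<A> g c f \<eta> T lam p e \<longleftrightarrow>
     (\<forall>i\<in>{1..CARD('n)}. \<forall>j\<in>{1..CARD('n)}. g p (e i) (e j) = (if i = j then 1 else 0)) \<and>
     (\<forall>i\<in>{1..CARD('n)}. principal_curvature_along \<A> c f \<eta> p (e i) (lam i p)) \<and>
     e (CARD('n)) = (1 / rnorm g p (T p)) *\<^sub>R T p"

text \<open>At each point the functions \<open>lam 1, \<dots>, lam n\<close> list the principal curvatures with
  multiplicity, \<open>lam n\<close> being the one associated to \<open>T\<close>.\<close>

definition principal_curvatures ::
    "('m, 'n::finite) atlas \<Rightarrow> ('m \<Rightarrow> real^'n \<Rightarrow> real^'n \<Rightarrow> real) \<Rightarrow> real \<Rightarrow>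
     ('m \<Rightarrow> 'n ambient) \<Rightarrow> ('m \<Rightarrow> 'n ambient) \<Rightarrow> ('m \<Rightarrow> real^'n) \<Rightarrow> (nat \<Rightarrow> 'm \<Rightarrow> real) \<Rightarrow> bool" where
  "principal_curvatures \<A> g c f \<eta> T lam \<longleftrightarrow>
     (\<forall>p. \<exists>e. adapted_principal_basis \<A> g c f \<eta> T lam p e)"

definition constant_multiplicities ::
    "('m, 'n::finite) atlas \<Rightarrow> real \<Rightarrow> ('m \<Rightarrow> 'n ambient) \<Rightarrow> ('m \<Rightarrow> 'n ambient) \<Rightarrow>
     (nat \<Rightarrow> 'm \<Rightarrow> real) \<Rightarrow> bool" where
  "constant_multiplicities \<A> c f \<eta> lam \<longleftrightarrow>
     (\<forall>i\<in>{1..CARD('n)}. \<exists>m. \<forall>p. dim {v. shape_operator \<A> c f \<eta> p v = lam i p *\<^sub>R v} = m)"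

text \<open>No regularity of the frame is required: every smooth local frame is an instance.\<close>

definition adapted_principal_frame_on ::
    "('m, 'n::finite) atlas \<Rightarrow> ('m \<Rightarrow> real^'n \<Rightarrow> real^'n \<Rightarrow> real) \<Rightarrow> real \<Rightarrow>
     ('m \<Rightarrow> 'n ambient) \<Rightarrow> ('m \<Rightarrow> 'n ambient) \<Rightarrow> ('m \<Rightarrow> real^'n) \<Rightarrow> (nat \<Rightarrow> 'm \<Rightarrow> real) \<Rightarrow>
     'm set \<Rightarrow> (nat \<Rightarrow> 'm \<Rightarrow> real^'n) \<Rightarrow> bool" where
  "adapted_principal_frame_on \<A> g c f \<eta> T lam V X \<longleftrightarrow>
     (\<forall>p\<in>V. adapted_principal_basis \<A> g c f \<eta> T lam p (\<lambda>i. X i p))"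

section \<open>Parallel hypersurfaces\<close>

definition \<eta>Q :: "('m \<Rightarrow> 'n::finite ambient) \<Rightarrow> ('m \<Rightarrow> real) \<Rightarrow> 'm \<Rightarrow> 'n ambient" where
  "\<eta>Q \<eta> \<nu> p = \<eta> p - \<nu> p *\<^sub>R ddt"

definition parallel ::
    "('m \<Rightarrow> real^'n \<Rightarrow> real^'n \<Rightarrow> real) \<Rightarrow> real \<Rightarrow> ('m \<Rightarrow> 'n::finite ambient) \<Rightarrow>
     ('m \<Rightarrow> 'n ambient) \<Rightarrow> ('m \<Rightarrow> real^'n) \<Rightarrow> ('m \<Rightarrow> real) \<Rightarrow> real \<Rightarrow> 'm \<Rightarrow> 'n ambient" where
  "parallel g c f \<eta> T \<nu> t p = (let r = rnorm g p (T p) in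
     C c (r * t) *\<^sub>R \<xi> (f p) + (S c (r * t) / r) *\<^sub>R \<eta>Q \<eta> \<nu> p + (height (f p) + t * \<nu> p) *\<^sub>R ddt)"

definition parallel_normal ::
    "('m \<Rightarrow> real^'n \<Rightarrow> real^'n \<Rightarrow> real) \<Rightarrow> real \<Rightarrow> ('m \<Rightarrow> 'n::finite ambient) \<Rightarrow>
     ('m \<Rightarrow> 'n ambient) \<Rightarrow> ('m \<Rightarrow> real^'n) \<Rightarrow> ('m \<Rightarrow> real) \<Rightarrow> real \<Rightarrow> 'm \<Rightarrow> 'n ambient" where
  "parallel_normal g c f \<eta> T \<nu> t p = (let r = rnorm g p (T p) in
     (- c * r * S c (r * t)) *\<^sub>R \<xi> (f p) + C c (r * t) *\<^sub>R \<eta>Q \<eta> \<nu> p + \<nu> p *\<^sub>R ddt)"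

end

theory Submission
  imports Defs
begin

text \<open>Taking the product of \<open>\<partial>/\<partial>t = df(T) + \<nu>\<eta>\<close> with \<open>\<eta>\<close> and with \<open>df(X)\<close> shows that \<open>\<nu>\<close> is the
  height of \<open>\<eta>\<close>, that \<open>\<parallel>T\<parallel>\<^sup>2 = 1 - \<nu>\<^sup>2\<close> and that \<open>df(X)\<close> has height \<open>g(X, T)\<close>. Hence the parallel
  hypersurface and its normal are explicit functions of \<open>f\<close> and \<open>\<eta>\<close>, and their derivatives follow
  from the Weingarten equation \<open>d\<eta>(X) = c \<nu> g(X, T) \<xi> - df(AX)\<close>. For a principal direction
  \<open>X \<bottom> T\<close> the functions \<open>\<nu>\<close> and \<open>\<parallel>T\<parallel>\<close> are stationary, and both derivatives are multiples of
  \<open>df(X)\<close>. For \<open>X = T/\<parallel>T\<parallel>\<close>, writing \<open>u = \<eta>\<^sub>Q/\<parallel>T\<parallel>\<close>, the terms combine to multiples of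
  \<open>z = c \<nu> S \<xi> - \<nu> C u + \<parallel>T\<parallel> \<partial>/\<partial>t\<close>, with factor \<open>1 - t\<lambda>\<close> for \<open>f\<^sub>t\<close> and \<open>-\<lambda>\<close> for \<open>\<eta>\<^sub>t\<close>, the
  latter up to a vector normal to the ambient hypersurface.\<close>

section \<open>The flat metric and the linear maps \<open>height\<close> and
  \<open>\<xi>\<close>\<close>

lemma flat_bilinear: "bilinear (flat c)"
  by (auto simp: bilinear_def flat_def split_def linear_iff algebra_simps)

lemmas flat_simps =
  bilinear_ladd[OF flat_bilinear] bilinear_radd[OF flat_bilinear]
  bilinear_lsub[OF flat_bilinear] bilinear_rsub[OF flat_bilinear]
  bilinear_lmul[OF flat_bilinear] bilinear_rmul[OF flat_bilinear]
  bilinear_lneg[OF flat_bilinear] bilinear_rneg[OF flat_bilinear]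
  bilinear_lzero[OF flat_bilinear] bilinear_rzero[OF flat_bilinear]

lemma flat_commute: "flat c z w = flat c w z"
  by (auto simp: flat_def split_def inner_commute)

lemma flat_bounded_bilinear: "bounded_bilinear (flat c)"
  using flat_bilinear bilinear_conv_bounded_bilinear by blast

lemma height_bounded_linear: "bounded_linear height"
  unfolding linear_conv_bounded_linear[symmetric]
  by (auto simp: height_def split_def linear_iff)

lemma \<xi>_bounded_linear: "bounded_linear \<xi>"
  unfolding linear_conv_bounded_linear[symmetric]
  by (auto simp: \<xi>_def split_def linear_iff)

lemmas height_linear_simps = linear_add[OF bounded_linear.linear[OF height_bounded_linear]]
  linear_diff[OF bounded_linear.linear[OF height_bounded_linear]]
  linear_scale[OF bounded_linear.linear[OF height_bounded_linear]]

lemmas \<xi>_linear_simps = linear_add[OF bounded_linear.linear[OF \<xi>_bounded_linear]]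
  linear_diff[OF bounded_linear.linear[OF \<xi>_bounded_linear]]
  linear_scale[OF bounded_linear.linear[OF \<xi>_bounded_linear]]

lemma height_ddt [simp]: "height ddt = 1"
  by (simp add: height_def ddt_def)

lemma height_\<xi> [simp]: "height (\<xi> z) = 0"
  by (simp add: height_def \<xi>_def split_def)

lemma \<xi>_ddt [simp]: "\<xi> ddt = 0"
  by (simp add: \<xi>_def ddt_def zero_prod_def)

lemma \<xi>_\<xi> [simp]: "\<xi> (\<xi> z) = \<xi> z"
  by (simp add: \<xi>_def split_def)

lemma flat_ddt [simp]: "flat c z ddt = height z" "flat c ddt z = height z"
  by (auto simp: flat_def ddt_def height_def split_def)

lemma \<xi>_eq: "\<xi> z = z - height z *\<^sub>R ddt"
  by (auto simp: \<xi>_def height_def ddt_def split_def prod_eq_iff)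

lemma QxR_flat_\<xi>: "z \<in> QxR c \<Longrightarrow> flat c (\<xi> z) (\<xi> z) = c"
  by (auto simp: QxR_def flat_def \<xi>_def split_def power2_eq_square)

lemma C_has_derivative:
  assumes "c \<in> {1, -1}"
  shows "(C c has_real_derivative - c * S c u) (at u)"
  using assms by (auto simp: C_def[abs_def] S_def intro!: derivative_eq_intros)

lemma S_has_derivative: "(S c has_real_derivative C c u) (at u)"
  by (auto simp: C_def S_def[abs_def] intro!: derivative_eq_intros)

lemma C_S_square:
  assumes "c \<in> {1, -1}"
  shows "c * (C c u)\<^sup>2 + (S c u)\<^sup>2 = c"
  using assms by (auto simp: C_def S_def cosh_square_eq)

text \<open>Here \<open>\<sigma>\<close> is the inverse of the chart selected at \<open>p\<close>
  and \<open>a\<close> the coordinate vector of \<open>p\<close>, so questions about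
  \<open>differential\<close> become questions about Frechet derivatives at
  \<open>a\<close>.\<close>

lemma chart_at_coordinates:
  fixes \<A> :: "('m::{t2_space,second_countable_topology}, 'n::finite) atlas"
  assumes "smooth_atlas \<A>"
  obtains \<sigma> a where "\<sigma> a = p"
    "\<And>h :: 'm \<Rightarrow> 'b::real_normed_vector. differential \<A> h p = frechet_derivative (h \<circ> \<sigma>) (at a)"
    "\<And>h :: 'm \<Rightarrow> 'b. smooth_map_on \<A> UNIV h \<Longrightarrow> (h \<circ> \<sigma>) differentiable (at a)"
proof -
  obtain U \<phi> where ch: "chart_at \<A> p = (U, \<phi>)" by fastforce
  have "\<exists>ch. ch \<in> \<A> \<and> p \<in> fst ch"
    using assms by (force simp: smooth_atlas_def)
  then have "chart_at \<A> p \<in> \<A> \<and> p \<in> fst (chart_at \<A> p)"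
    unfolding chart_at_def by (rule someI_ex)
  then have U: "(U, \<phi>) \<in> \<A>" "p \<in> U" by (auto simp: ch)
  have "homeomorphism U (\<phi> ` U) \<phi> (inv_into U \<phi>)"
    using assms U by (force simp: smooth_atlas_def)
  then have inv: "inv_into U \<phi> (\<phi> p) = p" using U by (simp add: homeomorphism_def)
  show thesis
  proof
    show "inv_into U \<phi> (\<phi> p) = p" by (rule inv)
    show "differential \<A> h p = frechet_derivative (h \<circ> inv_into U \<phi>) (at (\<phi> p))"
      for h :: "'m \<Rightarrow> 'b" by (simp add: differential_def ch)
    show "(h \<circ> inv_into U \<phi>) differentiable (at (\<phi> p))"
      if "smooth_map_on \<A> UNIV h" for h :: "'m \<Rightarrow> 'b"
    proof -
      have "smooth_on (h \<circ> inv_into U \<phi>) (\<phi> ` U)"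
        using that U by (force simp: smooth_map_on_def)
      then have "Ck_on (Suc 0) (h \<circ> inv_into U \<phi>) (\<phi> ` U)"
        unfolding smooth_on_def by blast
      then show ?thesis using U by simp
    qed
  qed
qed

section \<open>First-order identities along the hypersurface\<close>

locale hypersurface_QxR =
  fixes c :: real
    and \<A> :: "('m::{t2_space,second_countable_topology}, 'n::finite) atlas"
    and g :: "'m \<Rightarrow> real^'n \<Rightarrow> real^'n \<Rightarrow> real"
    and f \<eta> :: "'m \<Rightarrow> 'n ambient"
    and T :: "'m \<Rightarrow> real^'n" and \<nu> :: "'m \<Rightarrow> real"
  assumes c: "c \<in> {1, -1}"
    and atlas: "smooth_atlas \<A>"
    and metric: "riemannian_metric \<A> g"
    and immersion: "isometric_immersion \<A> g c f"
    and normal: "unit_normal_field \<A> c f \<eta>"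
    and decomposition: "ddt_decomposition \<A> f \<eta> T \<nu>"
    and T_nonzero: "T q \<noteq> 0"
begin

abbreviation "df \<equiv> differential \<A> f"
abbreviation "d\<eta> \<equiv> differential \<A> \<eta>"
abbreviation "r q \<equiv> rnorm g q (T q)"

lemma c_square [simp]: "c * c = 1"
  using c by auto

lemma c_square_mult [simp]: "c * (c * x) = x"
  by (metis c_square mult.assoc mult_1)

lemma flat_\<eta>_\<eta>: "flat c (\<eta> q) (\<eta> q) = 1"
  and flat_\<eta>_\<xi>: "flat c (\<eta> q) (\<xi> (f q)) = 0"
  and flat_df_\<eta>: "flat c (df q v) (\<eta> q) = 0"
  using normal by (auto simp: unit_normal_field_def)

lemma flat_\<xi>_\<xi>: "flat c (\<xi> (f q)) (\<xi> (f q)) = c"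
  using immersion by (auto simp: isometric_immersion_def intro: QxR_flat_\<xi>)

lemma flat_df_df: "flat c (df q v) (df q w) = g q v w"
  using immersion by (auto simp: isometric_immersion_def)

lemma inj_df: "inj (df q)"
  using immersion by (auto simp: isometric_immersion_def immersed_at_def)

lemma ddt_eq: "ddt = df q (T q) + \<nu> q *\<^sub>R \<eta> q"
  using decomposition by (auto simp: ddt_decomposition_def)

lemma height_\<eta>: "height (\<eta> q) = \<nu> q"
proof -
  have "height (\<eta> q) = flat c (df q (T q) + \<nu> q *\<^sub>R \<eta> q) (\<eta> q)"
    by (simp flip: ddt_eq)
  then show ?thesis by (simp add: flat_simps flat_df_\<eta> flat_\<eta>_\<eta>)
qed

lemma height_df: "height (df q v) = g q v (T q)"
proof -
  have "height (df q v) = flat c (df q v) (df q (T q) + \<nu> q *\<^sub>R \<eta> q)"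
    by (simp flip: ddt_eq)
  then show ?thesis by (simp add: flat_simps flat_df_\<eta> flat_df_df)
qed

lemma g_T_T: "g q (T q) (T q) = 1 - (\<nu> q)\<^sup>2"
  using arg_cong[OF ddt_eq, of height q]
  by (simp add: height_linear_simps height_df height_\<eta> power2_eq_square)

text \<open>Positivity keeps the square root in \<open>r_eq\<close> away from its singular point and
  allows division by \<open>r\<close>.\<close>

lemma T_positive: "0 < 1 - (\<nu> q)\<^sup>2"
  using metric T_nonzero unfolding g_T_T[symmetric] riemannian_metric_def by blast

lemma r_eq: "r q = sqrt (1 - (\<nu> q)\<^sup>2)"
  by (simp add: rnorm_def g_T_T)

lemma r_positive: "0 < r q"
  using T_positive by (simp add: r_eq)

lemma r_square: "r q * r q = 1 - \<nu> q * \<nu> q"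
  using T_positive[of q] by (simp add: r_eq power2_eq_square)

text \<open>As a linear image of \<open>\<eta>\<close>, this vector can be differentiated without a
  product rule.\<close>

lemma \<eta>Q_eq: "\<eta>Q \<eta> \<nu> q = \<xi> (\<eta> q)"
  by (simp add: \<eta>Q_def \<xi>_eq height_\<eta>)

text \<open>One parametrization serves \<open>f\<close>, \<open>\<eta>\<close> and everything built
  from them. By the last clause a derivative computed in it is the differential, with no prior proof
  of smoothness.\<close>

lemma coordinates:
  obtains \<sigma> a where "\<sigma> a = p"
    "((\<lambda>y. f (\<sigma> y)) has_derivative df p) (at a)"
    "((\<lambda>y. \<eta> (\<sigma> y)) has_derivative d\<eta> p) (at a)"
    "\<forall>h (D :: real^'n \<Rightarrow> 'n ambient).
      ((\<lambda>y. h (\<sigma> y)) has_derivative D) (at a) \<longrightarrow> differential \<A> h p = D"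
proof -
  obtain \<sigma> a where \<sigma>: "\<sigma> a = p"
    "\<And>h :: 'm \<Rightarrow> 'n ambient. differential \<A> h p = frechet_derivative (h \<circ> \<sigma>) (at a)"
    "\<And>h :: 'm \<Rightarrow> 'n ambient. smooth_map_on \<A> UNIV h \<Longrightarrow> (h \<circ> \<sigma>) differentiable (at a)"
    using chart_at_coordinates[OF atlas] by metis
  show thesis
  proof (rule that[of \<sigma> a])
    show "\<sigma> a = p" by (rule \<sigma>(1))
    have "(f \<circ> \<sigma>) differentiable (at a)"
      using immersion by (intro \<sigma>) (simp add: isometric_immersion_def)
    then show "((\<lambda>y. f (\<sigma> y)) has_derivative df p) (at a)"
      by (simp add: \<sigma>(2) frechet_derivative_works o_def)
    have "(\<eta> \<circ> \<sigma>) differentiable (at a)"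
      using normal by (intro \<sigma>) (simp add: unit_normal_field_def)
    then show "((\<lambda>y. \<eta> (\<sigma> y)) has_derivative d\<eta> p) (at a)"
      by (simp add: \<sigma>(2) frechet_derivative_works o_def)
    show "\<forall>h (D :: real^'n \<Rightarrow> 'n ambient).
        ((\<lambda>y. h (\<sigma> y)) has_derivative D) (at a) \<longrightarrow> differential \<A> h p = D"
      by (auto simp: \<sigma>(2) o_def dest: frechet_derivative_at)
  qed
qed

lemma linear_df: "linear (df q)"
  by (rule coordinates[of q]) (rule has_derivative_linear)

text \<open>These come from differentiating the constant products of \<open>\<xi> (f p)\<close> with
  itself, of \<open>\<eta> p\<close> with itself, and of the two with each other. In the last case
  \<open>\<xi>\<close> removes the height of \<open>df p v\<close>, which leaves the term with
  \<open>\<nu>\<close>.\<close>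

lemma flat_df_\<xi>: "flat c (df p v) (\<xi> (f p)) = 0"
  and flat_d\<eta>_\<eta>: "flat c (d\<eta> p v) (\<eta> p) = 0"
  and flat_d\<eta>_\<xi>: "flat c (d\<eta> p v) (\<xi> (f p)) = \<nu> p * g p v (T p)"
proof -
  obtain \<sigma> a where \<sigma>: "\<sigma> a = p"
    and F: "((\<lambda>y. f (\<sigma> y)) has_derivative df p) (at a)"
    and N: "((\<lambda>y. \<eta> (\<sigma> y)) has_derivative d\<eta> p) (at a)"
    by (rule coordinates)
  note \<Xi> = bounded_linear.has_derivative[OF \<xi>_bounded_linear F]
  note product = bounded_bilinear.FDERIV[OF flat_bounded_bilinear]
  have const: "D v = 0" if "((\<lambda>y. k) has_derivative D) (at a)" for k :: real and D
    using has_derivative_unique[OF that has_derivative_const] by simp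
  from const[OF product[OF \<Xi> \<Xi>, of c, unfolded flat_\<xi>_\<xi>]]
  show "flat c (df p v) (\<xi> (f p)) = 0"
    by (simp add: \<sigma> flat_commute[of c "\<xi> (f p)"] \<xi>_eq[of "df p v"] flat_simps)
  from const[OF product[OF N N, of c, unfolded flat_\<eta>_\<eta>]]
  show "flat c (d\<eta> p v) (\<eta> p) = 0"
    by (simp add: \<sigma> flat_commute[of c "\<eta> p"])
  from const[OF product[OF N \<Xi>, of c, unfolded flat_\<eta>_\<xi>]]
  show "flat c (d\<eta> p v) (\<xi> (f p)) = \<nu> p * g p v (T p)"
    by (simp add: \<sigma> \<xi>_eq[of "df p v"] flat_simps flat_commute[of c "\<eta> p" "df p v"]
        flat_df_\<eta> height_df height_\<eta>)
qed

text \<open>The image of \<open>df\<close>, \<open>\<xi>\<close> and \<open>\<eta>\<close> span the ambient space: the map \<open>L\<close> below is an injective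
  linear endomorphism of it, since \<open>'n ambient\<close> is a product of copies of the three spaces of
  coefficients. This avoids any use of definiteness of the flat metric.\<close>

lemma tangent_iff: "(\<exists>w. z = df p w) \<longleftrightarrow> flat c z (\<xi> (f p)) = 0 \<and> flat c z (\<eta> p) = 0"
proof
  define L where "L = (\<lambda>(a, v, b). a *\<^sub>R \<xi> (f p) + df p v + b *\<^sub>R \<eta> p)"
  \<comment> \<open>Since \<open>c\<close> is nonzero, these pairings recover \<open>a\<close> and
    \<open>b\<close>. They serve twice: for the injectivity of \<open>L\<close>, and to remove the
    normal coefficients of \<open>z\<close>.\<close>
  have flat_L: "flat c (L (a, v, b)) (\<xi> (f p)) = a * c" "flat c (L (a, v, b)) (\<eta> p) = b" for a v b
    by (simp_all add: L_def flat_simps flat_\<xi>_\<xi> flat_df_\<xi> flat_\<eta>_\<xi> flat_df_\<eta> flat_\<eta>_\<eta>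
        flat_commute[of c "\<xi> (f p)" "\<eta> p"])
  have lin: "linear L"
    by (auto simp: L_def split_def linear_iff linear_add[OF linear_df] linear_scale[OF linear_df]
        algebra_simps)
  have "x = 0" if "L x = 0" for x
  proof -
    obtain a v b where x: "x = (a, v, b)" by (cases x)
    have "a * c = 0" "b = 0"
      using flat_L[of a v b] that by (auto simp: x flat_simps)
    then have "a = 0" "b = 0" using c by auto
    with that have "df p v = 0" by (simp add: x L_def)
    then have "v = 0" using inj_df linear_injective_0[OF linear_df] by blast
    with \<open>a = 0\<close> \<open>b = 0\<close> show ?thesis by (simp add: x zero_prod_def)
  qed
  then have "surj L"
    using lin linear_injective_0 linear_injective_imp_surjective by blast
  then obtain a v b where z: "z = L (a, v, b)" by (metis surjD prod_cases3)
  assume "flat c z (\<xi> (f p)) = 0 \<and> flat c z (\<eta> p) = 0"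
  then have "a = 0" "b = 0" using c by (auto simp: z flat_L)
  then show "\<exists>w. z = df p w" by (auto simp: z L_def)
qed (auto simp: flat_df_\<xi> flat_df_\<eta>)

text \<open>The definite description in \<open>shape_operator\<close> is resolved first: a solution
  exists by \<open>tangent_iff\<close>, and it is unique because \<open>df p\<close> is injective.
  Restoring the component along \<open>\<xi> (f p)\<close> then gives
  \<open>d\<eta>\<close>.\<close>

lemma Weingarten:
  assumes "shape_operator \<A> c f \<eta> p v = l *\<^sub>R v"
  shows "d\<eta> p v = (c * \<nu> p * g p v (T p)) *\<^sub>R \<xi> (f p) - l *\<^sub>R df p v"
proof -
  let ?P = "\<lambda>w. covariant_derivative \<A> c f \<eta> p v = - df p w"
  have "\<exists>w. covariant_derivative \<A> c f \<eta> p v = df p w"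
    by (simp add: tangent_iff covariant_derivative_def flat_simps flat_\<xi>_\<xi> flat_d\<eta>_\<eta>
        flat_commute[of c "\<xi> (f p)" "\<eta> p"] flat_\<eta>_\<xi>)
  then obtain w where "covariant_derivative \<A> c f \<eta> p v = df p w" ..
  then have "?P (- w)" by (simp add: linear_neg[OF linear_df])
  moreover have "x = y" if "?P x" "?P y" for x y
    using that inj_df[of p] by (simp add: inj_eq)
  ultimately have "\<exists>!w. ?P w" by blast
  from theI'[OF this] have "?P (l *\<^sub>R v)"
    using assms by (simp add: shape_operator_def)
  then show ?thesis
    by (simp add: covariant_derivative_def flat_d\<eta>_\<xi> linear_scale[OF linear_df] algebra_simps)
qed

section \<open>Derivatives of the parallel hypersurface and its normal\<close>

lemma parallel_eq: "parallel g c f \<eta> T \<nu> t q =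
    C c (r q * t) *\<^sub>R \<xi> (f q) + (S c (r q * t) / r q) *\<^sub>R \<xi> (\<eta> q) + (height (f q) + t * \<nu> q) *\<^sub>R ddt"
  by (simp add: parallel_def Let_def \<eta>Q_eq)

lemma parallel_normal_eq: "parallel_normal g c f \<eta> T \<nu> t q =
    (- c * r q * S c (r q * t)) *\<^sub>R \<xi> (f q) + C c (r q * t) *\<^sub>R \<xi> (\<eta> q) + \<nu> q *\<^sub>R ddt"
  by (simp add: parallel_normal_def Let_def \<eta>Q_eq)

text \<open>Since \<open>\<parallel>T\<parallel>\<^sup>2 = 1 - \<nu>\<^sup>2\<close> and \<open>\<nu>\<close> is the height of \<open>\<eta>\<close>, the number \<open>\<rho>\<close> below is the
  derivative of \<open>\<parallel>T\<parallel>\<close> in the direction \<open>v\<close>.\<close>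

lemma
  fixes p v t
  defines "\<rho> \<equiv> - (\<nu> p * height (d\<eta> p v) / r p)"
  shows differential_parallel: "differential \<A> (parallel g c f \<eta> T \<nu> t) p v =
      (- c * S c (r p * t) * \<rho> * t) *\<^sub>R \<xi> (f p) + C c (r p * t) *\<^sub>R \<xi> (df p v)
      + (C c (r p * t) * \<rho> * t / r p - S c (r p * t) * \<rho> / (r p * r p)) *\<^sub>R \<xi> (\<eta> p)
      + (S c (r p * t) / r p) *\<^sub>R \<xi> (d\<eta> p v)
      + (height (df p v) + t * height (d\<eta> p v)) *\<^sub>R ddt"
    and differential_parallel_normal: "differential \<A> (parallel_normal g c f \<eta> T \<nu> t) p v =
      (- c * (\<rho> * S c (r p * t) + r p * C c (r p * t) * \<rho> * t)) *\<^sub>R \<xi> (f p)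
      + (- c * r p * S c (r p * t)) *\<^sub>R \<xi> (df p v)
      + (- c * S c (r p * t) * \<rho> * t) *\<^sub>R \<xi> (\<eta> p) + C c (r p * t) *\<^sub>R \<xi> (d\<eta> p v)
      + height (d\<eta> p v) *\<^sub>R ddt"
    and linear_differential_parallel: "linear (differential \<A> (parallel g c f \<eta> T \<nu> t) p)"
proof -
  obtain \<sigma> a where \<sigma>: "\<sigma> a = p"
    and F: "((\<lambda>y. f (\<sigma> y)) has_derivative df p) (at a)"
    and N: "((\<lambda>y. \<eta> (\<sigma> y)) has_derivative d\<eta> p) (at a)"
    and "\<forall>h (D :: real^'n \<Rightarrow> 'n ambient).
      ((\<lambda>y. h (\<sigma> y)) has_derivative D) (at a) \<longrightarrow> differential \<A> h p = D"
    by (rule coordinates)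
  note D = this(4)[rule_format]
  note linear_images =
    bounded_linear.has_derivative[OF \<xi>_bounded_linear F]
    bounded_linear.has_derivative[OF \<xi>_bounded_linear N]
    bounded_linear.has_derivative[OF height_bounded_linear F]
  have V: "((\<lambda>y. \<nu> (\<sigma> y)) has_derivative (\<lambda>w. height (d\<eta> p w))) (at a)"
    using bounded_linear.has_derivative[OF height_bounded_linear N] by (simp add: height_\<eta>)
  have V2: "((\<lambda>y. 1 - (\<nu> (\<sigma> y))\<^sup>2) has_derivative (\<lambda>w. - (2 * \<nu> p * height (d\<eta> p w)))) (at a)"
    by (rule has_derivative_eq_rhs,
        rule has_derivative_diff[OF has_derivative_const has_derivative_power[OF V]])
      (simp add: fun_eq_iff \<sigma>)
  have R: "((\<lambda>y. r (\<sigma> y)) has_derivative (\<lambda>w. - (\<nu> p * height (d\<eta> p w) / r p))) (at a)"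
    unfolding r_eq
    by (rule has_derivative_eq_rhs, rule DERIV_compose_FDERIV[OF DERIV_real_sqrt V2])
      (simp_all only: \<sigma> T_positive, simp add: fun_eq_iff field_simps)
  have CR: "((\<lambda>y. C c (r (\<sigma> y) * t)) has_derivative
      (\<lambda>w. - c * S c (r p * t) * (- (\<nu> p * height (d\<eta> p w) / r p)) * t)) (at a)"
    by (rule has_derivative_eq_rhs[OF DERIV_compose_FDERIV[OF C_has_derivative[OF c]
            has_derivative_mult_left[OF R]]]) (simp add: fun_eq_iff \<sigma> mult_ac)
  have SR: "((\<lambda>y. S c (r (\<sigma> y) * t)) has_derivative
      (\<lambda>w. C c (r p * t) * (- (\<nu> p * height (d\<eta> p w) / r p)) * t)) (at a)"
    by (rule has_derivative_eq_rhs[OF DERIV_compose_FDERIV[OF S_has_derivative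
            has_derivative_mult_left[OF R]]]) (simp add: fun_eq_iff \<sigma> mult_ac)
  \<comment> \<open>The second form discharges the side condition of the quotient rule, which arises
    before \<open>\<sigma> a\<close> is rewritten to \<open>p\<close>.\<close>
  have r0: "r p \<noteq> 0" and r0': "r (\<sigma> a) \<noteq> 0"
    using r_positive[of p] by (simp_all add: \<sigma>)
  \<comment> \<open>The known derivatives come first, and the rules for a constant factor precede
    the general product rules.\<close>
  note rules = CR SR R V linear_images r0' has_derivative_add has_derivative_scaleR_left
    has_derivative_scaleR has_derivative_divide' has_derivative_mult_right has_derivative_mult
  \<comment> \<open>The value of \<open>\<rho>\<close> is written out because the direction is now a
    bound variable.\<close>
  have P: "((\<lambda>y. parallel g c f \<eta> T \<nu> t (\<sigma> y)) has_derivative (\<lambda>v.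
      (- c * S c (r p * t) * (- (\<nu> p * height (d\<eta> p v) / r p)) * t) *\<^sub>R \<xi> (f p)
      + C c (r p * t) *\<^sub>R \<xi> (df p v)
      + (C c (r p * t) * (- (\<nu> p * height (d\<eta> p v) / r p)) * t / r p
          - S c (r p * t) * (- (\<nu> p * height (d\<eta> p v) / r p)) / (r p * r p)) *\<^sub>R \<xi> (\<eta> p)
      + (S c (r p * t) / r p) *\<^sub>R \<xi> (d\<eta> p v)
      + (height (df p v) + t * height (d\<eta> p v)) *\<^sub>R ddt)) (at a)"
    unfolding parallel_eq
    by (rule has_derivative_eq_rhs, (rule rules)+)
      (use r0 in \<open>simp add: fun_eq_iff \<sigma> algebra_simps diff_divide_distrib\<close>)
  have Q: "((\<lambda>y. parallel_normal g c f \<eta> T \<nu> t (\<sigma> y)) has_derivative (\<lambda>v.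
      (- c * (- (\<nu> p * height (d\<eta> p v) / r p) * S c (r p * t)
         + r p * C c (r p * t) * (- (\<nu> p * height (d\<eta> p v) / r p)) * t)) *\<^sub>R \<xi> (f p)
      + (- c * r p * S c (r p * t)) *\<^sub>R \<xi> (df p v)
      + (- c * S c (r p * t) * (- (\<nu> p * height (d\<eta> p v) / r p)) * t) *\<^sub>R \<xi> (\<eta> p)
      + C c (r p * t) *\<^sub>R \<xi> (d\<eta> p v) + height (d\<eta> p v) *\<^sub>R ddt)) (at a)"
    unfolding parallel_normal_eq
    by (rule has_derivative_eq_rhs, (rule rules)+)
      (use r0 in \<open>simp add: fun_eq_iff \<sigma> algebra_simps\<close>)
  show "differential \<A> (parallel g c f \<eta> T \<nu> t) p v =
      (- c * S c (r p * t) * \<rho> * t) *\<^sub>R \<xi> (f p) + C c (r p * t) *\<^sub>R \<xi> (df p v)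
      + (C c (r p * t) * \<rho> * t / r p - S c (r p * t) * \<rho> / (r p * r p)) *\<^sub>R \<xi> (\<eta> p)
      + (S c (r p * t) / r p) *\<^sub>R \<xi> (d\<eta> p v)
      + (height (df p v) + t * height (d\<eta> p v)) *\<^sub>R ddt"
    unfolding D[OF P] \<rho>_def ..
  show "differential \<A> (parallel_normal g c f \<eta> T \<nu> t) p v =
      (- c * (\<rho> * S c (r p * t) + r p * C c (r p * t) * \<rho> * t)) *\<^sub>R \<xi> (f p)
      + (- c * r p * S c (r p * t)) *\<^sub>R \<xi> (df p v)
      + (- c * S c (r p * t) * \<rho> * t) *\<^sub>R \<xi> (\<eta> p) + C c (r p * t) *\<^sub>R \<xi> (d\<eta> p v)
      + height (d\<eta> p v) *\<^sub>R ddt"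
    unfolding D[OF Q] \<rho>_def ..
  show "linear (differential \<A> (parallel g c f \<eta> T \<nu> t) p)"
    unfolding D[OF P] by (rule has_derivative_linear[OF P])
qed

end

section \<open>Recognizing principal curvatures\<close>

lemma principal_curvature_alongI:
  assumes "immersed_at \<A> h p" "linear (differential \<A> h p)" "v \<noteq> 0"
    and "covariant_derivative \<A> c h N p v = - l *\<^sub>R differential \<A> h p v"
  shows "principal_curvature_along \<A> c h N p v l"
proof -
  have "shape_operator \<A> c h N p v = l *\<^sub>R v"
    unfolding shape_operator_def
  proof (rule the_equality)
    show "covariant_derivative \<A> c h N p v = - differential \<A> h p (l *\<^sub>R v)"
      using assms by (simp add: linear_scale)
    show "w = l *\<^sub>R v" if "covariant_derivative \<A> c h N p v = - differential \<A> h p w" for w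
    proof -
      have "differential \<A> h p (l *\<^sub>R v) = differential \<A> h p w"
        using that assms(4) by (simp add: linear_scale[OF assms(2)])
      then show ?thesis using assms(1) by (simp add: immersed_at_def inj_eq)
    qed
  qed
  then show ?thesis using assms by (simp add: principal_curvature_along_def)
qed

text \<open>The denominator \<open>a\<close> cannot vanish because \<open>h\<close> is an immersion at \<open>p\<close>.\<close>

lemma principal_curvature_along_quotient:
  assumes "immersed_at \<A> h p" "linear (differential \<A> h p)" "v \<noteq> 0" "c \<in> {1, -1}"
    and dh: "differential \<A> h p v = a *\<^sub>R z"
    and dN: "differential \<A> N p v = k *\<^sub>R \<xi> (h p) - b *\<^sub>R z"
    and "flat c z (\<xi> (h p)) = 0" "flat c (\<xi> (h p)) (\<xi> (h p)) = c"
  shows "principal_curvature_along \<A> c h N p v (b / a)"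
proof (rule principal_curvature_alongI[OF assms(1-3)])
  have "differential \<A> h p v \<noteq> 0"
    using assms(1-3) linear_injective_0[OF assms(2)] by (auto simp: immersed_at_def)
  then have "a \<noteq> 0" by (auto simp: dh)
  \<comment> \<open>Hence the projection in \<open>covariant_derivative\<close> removes exactly
    \<open>k *\<^sub>R \<xi> (h p)\<close>.\<close>
  moreover have "c * (k * c) = k" using assms by auto
  moreover have "flat c (differential \<A> N p v) (\<xi> (h p)) = k * c"
    using assms by (simp add: dN flat_simps)
  ultimately show "covariant_derivative \<A> c h N p v = - (b / a) *\<^sub>R differential \<A> h p v"
    by (simp add: covariant_derivative_def dh dN)
qed

section \<open>Principal curvatures of the parallel hypersurfaces\<close>

context hypersurface_QxR
begin

lemma \<xi>_parallel: "\<xi> (parallel g c f \<eta> T \<nu> t p) =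
    C c (r p * t) *\<^sub>R \<xi> (f p) + (S c (r p * t) / r p) *\<^sub>R \<xi> (\<eta> p)"
  by (simp add: parallel_eq \<xi>_linear_simps)

lemma flat_\<xi>\<eta>: "flat c z (\<xi> (\<eta> p)) = flat c z (\<eta> p) - height z * \<nu> p"
  by (simp add: \<xi>_eq[of "\<eta> p"] flat_simps height_\<eta>)

lemma flat_\<xi>f_\<xi>\<eta>: "flat c (\<xi> (f p)) (\<xi> (\<eta> p)) = 0" "flat c (\<xi> (\<eta> p)) (\<xi> (f p)) = 0"
  and flat_\<xi>\<eta>_\<xi>\<eta>: "flat c (\<xi> (\<eta> p)) (\<xi> (\<eta> p)) = r p * r p"
  by (simp_all add: flat_\<xi>\<eta> flat_commute[of c "\<xi> (\<eta> p)"] flat_\<eta>_\<xi> flat_commute[of c "\<xi> (f p)"]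
      flat_commute[of c "\<eta> p" "\<xi> (\<eta> p)"] flat_\<eta>_\<eta> height_\<eta> r_square)

text \<open>The vectors \<open>\<xi> (f p)\<close> and \<open>\<xi> (\<eta> p)\<close> are
  orthogonal with squares \<open>c\<close> and \<open>r p * r p\<close>, so this is the identity
  \<open>C_S_square\<close>.\<close>

lemma flat_\<xi>_parallel:
  "flat c (\<xi> (parallel g c f \<eta> T \<nu> t p)) (\<xi> (parallel g c f \<eta> T \<nu> t p)) = c"
  using C_S_square[OF c, of "r p * t"] r_positive[of p]
  by (simp add: \<xi>_parallel flat_simps flat_\<xi>_\<xi> flat_\<xi>f_\<xi>\<eta> flat_\<xi>\<eta>_\<xi>\<eta> power2_eq_square mult_ac)

text \<open>Orthogonality to \<open>T\<close> makes the heights of \<open>df p v\<close> and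
  \<open>d\<eta> p v\<close> vanish. Hence \<open>\<xi>\<close> fixes both vectors,
  \<open>\<rho>\<close> is zero, and only multiples of \<open>df p v\<close> survive.\<close>

lemma principal_curvature_orthogonal:
  assumes "immersed_at \<A> (parallel g c f \<eta> T \<nu> t) p"
    and v: "principal_curvature_along \<A> c f \<eta> p v l" and orth: "g p v (T p) = 0"
  shows "principal_curvature_along \<A> c (parallel g c f \<eta> T \<nu> t) (parallel_normal g c f \<eta> T \<nu> t) p v
    ((c * r p * S c (r p * t) + l * C c (r p * t)) /
     (C c (r p * t) - l * inverse (r p) * S c (r p * t)))"
proof (rule principal_curvature_along_quotient[OF assms(1) linear_differential_parallel _ c
        _ _ _ flat_\<xi>_parallel, where z = "df p v" and k = 0])
  have d\<eta>: "d\<eta> p v = - l *\<^sub>R df p v"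
    using Weingarten[of p v l] v orth
    by (simp add: principal_curvature_along_def)
  have h: "height (df p v) = 0" by (simp add: height_df orth)
  then have h': "height (d\<eta> p v) = 0" by (simp only: d\<eta> height_linear_simps) simp
  have \<xi>: "\<xi> (df p v) = df p v" by (simp add: \<xi>_eq h)
  have \<xi>': "\<xi> (d\<eta> p v) = - l *\<^sub>R df p v" by (simp only: \<xi>_eq h') (simp add: d\<eta>)
  show "v \<noteq> 0" using v by (simp add: principal_curvature_along_def)
  show "differential \<A> (parallel g c f \<eta> T \<nu> t) p v =
      (C c (r p * t) - l * inverse (r p) * S c (r p * t)) *\<^sub>R df p v"
    by (simp add: differential_parallel h h' \<xi> \<xi>' divide_inverse algebra_simps)
  show "differential \<A> (parallel_normal g c f \<eta> T \<nu> t) p v =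
      0 *\<^sub>R \<xi> (parallel g c f \<eta> T \<nu> t p)
      - (c * r p * S c (r p * t) + l * C c (r p * t)) *\<^sub>R df p v"
    by (simp add: differential_parallel_normal h h' \<xi> \<xi>' algebra_simps)
  show "flat c (df p v) (\<xi> (parallel g c f \<eta> T \<nu> t p)) = 0"
    by (simp add: \<xi>_parallel flat_simps flat_df_\<xi> flat_\<xi>\<eta> flat_df_\<eta> h)
qed

lemma principal_curvature_T:
  assumes "immersed_at \<A> (parallel g c f \<eta> T \<nu> t) p"
    and v: "principal_curvature_along \<A> c f \<eta> p v l" "v = (1 / r p) *\<^sub>R T p"
  shows "principal_curvature_along \<A> c (parallel g c f \<eta> T \<nu> t) (parallel_normal g c f \<eta> T \<nu> t) p v
    (l / (1 - t * l))"
\<comment> \<open>The vector \<open>z\<close> has unit length and equals \<open>df p v\<close> at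
  \<open>t = 0\<close>. The number \<open>k\<close> is found by comparing the coefficients of
  \<open>\<xi> (f p)\<close> once \<open>- l *\<^sub>R z\<close> is split off.\<close>
proof (rule principal_curvature_along_quotient[OF assms(1) linear_differential_parallel _ c
        _ _ _ flat_\<xi>_parallel,
        where z = "(c * \<nu> p * S c (r p * t)) *\<^sub>R \<xi> (f p)
          - (\<nu> p * C c (r p * t) / r p) *\<^sub>R \<xi> (\<eta> p) + r p *\<^sub>R ddt"
        and k = "(1 - t * l) * c * r p * \<nu> p"])
  have r0: "r p \<noteq> 0" using r_positive[of p] by simp
  have df: "df p v = (1 / r p) *\<^sub>R (ddt - \<nu> p *\<^sub>R \<eta> p)"
    by (simp add: v(2) linear_scale[OF linear_df] ddt_eq[of p])
  have h: "height (df p v) = r p"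
    using r0 by (simp add: df height_linear_simps height_\<eta> flip: r_square)
  have d\<eta>: "d\<eta> p v = (c * \<nu> p * r p) *\<^sub>R \<xi> (f p) - l *\<^sub>R df p v"
    using Weingarten[of p v l] v(1) h by (simp add: principal_curvature_along_def height_df)
  have h': "height (d\<eta> p v) = - (l * r p)"
    by (simp add: d\<eta> height_linear_simps h)
  \<comment> \<open>So the derivative of \<open>r\<close> in the direction \<open>v\<close> is
    \<open>l * \<nu> p\<close>.\<close>
  have \<rho>: "\<nu> p * height (d\<eta> p v) / r p = - (l * \<nu> p)"
    using r0 by (simp add: h')
  have \<xi>: "\<xi> (df p v) = - (\<nu> p / r p) *\<^sub>R \<xi> (\<eta> p)"
    by (simp add: df \<xi>_linear_simps)
  have \<xi>': "\<xi> (d\<eta> p v) = (c * \<nu> p * r p) *\<^sub>R \<xi> (f p) + (l * \<nu> p / r p) *\<^sub>R \<xi> (\<eta> p)"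
    by (simp add: d\<eta> \<xi>_linear_simps \<xi>)
  show "v \<noteq> 0" using v by (simp add: principal_curvature_along_def)
  show "differential \<A> (parallel g c f \<eta> T \<nu> t) p v =
      (1 - t * l) *\<^sub>R ((c * \<nu> p * S c (r p * t)) *\<^sub>R \<xi> (f p)
          - (\<nu> p * C c (r p * t) / r p) *\<^sub>R \<xi> (\<eta> p) + r p *\<^sub>R ddt)"
    using r0 by (simp add: differential_parallel \<rho> h h' \<xi> \<xi>' algebra_simps diff_divide_distrib)
  show "differential \<A> (parallel_normal g c f \<eta> T \<nu> t) p v =
      ((1 - t * l) * c * r p * \<nu> p) *\<^sub>R \<xi> (parallel g c f \<eta> T \<nu> t p)
      - l *\<^sub>R ((c * \<nu> p * S c (r p * t)) *\<^sub>R \<xi> (f p)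
          - (\<nu> p * C c (r p * t) / r p) *\<^sub>R \<xi> (\<eta> p) + r p *\<^sub>R ddt)"
    using r0 by (simp add: differential_parallel_normal \<rho> h h' \<xi> \<xi>' \<xi>_parallel algebra_simps)
  show "flat c ((c * \<nu> p * S c (r p * t)) *\<^sub>R \<xi> (f p)
          - (\<nu> p * C c (r p * t) / r p) *\<^sub>R \<xi> (\<eta> p) + r p *\<^sub>R ddt)
      (\<xi> (parallel g c f \<eta> T \<nu> t p)) = 0"
    using r0 by (simp add: \<xi>_parallel flat_simps flat_\<xi>_\<xi> flat_\<xi>f_\<xi>\<eta> flat_\<xi>\<eta>_\<xi>\<eta> height_linear_simps
        mult_ac)
qed

end

theorem proposition4p1:
  fixes c t :: real
    and \<A> :: "('m::{t2_space,second_countable_topology}, 'n::finite) atlas"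
    and g :: "'m \<Rightarrow> real^'n \<Rightarrow> real^'n \<Rightarrow> real"
    and f \<eta> :: "'m \<Rightarrow> 'n ambient"
    and T :: "'m \<Rightarrow> real^'n" and \<nu> :: "'m \<Rightarrow> real"
    and lam :: "nat \<Rightarrow> 'm \<Rightarrow> real"
    and V :: "'m set" and X :: "nat \<Rightarrow> 'm \<Rightarrow> real^'n" and p :: 'm
  assumes "c \<in> {1, -1}"
    and "smooth_atlas \<A>" and "riemannian_metric \<A> g"
    and "isometric_immersion \<A> g c f" and "unit_normal_field \<A> c f \<eta>"
    and "ddt_decomposition \<A> f \<eta> T \<nu>"
    and "principal_direction \<A> c f \<eta> T"
    and "principal_curvatures \<A> g c f \<eta> T lam"
    and "constant_multiplicities \<A> c f \<eta> lam"
    and "open V" and "adapted_principal_frame_on \<A> g c f \<eta> T lam V X"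
    and "p \<in> V" and "immersed_at \<A> (parallel g c f \<eta> T \<nu> t) p"
  shows "(\<forall>i\<in>{1..CARD('n)}. i \<noteq> CARD('n) \<longrightarrow>
            principal_curvature_along \<A> c (parallel g c f \<eta> T \<nu> t) (parallel_normal g c f \<eta> T \<nu> t)
              p (X i p)
              ((c * rnorm g p (T p) * S c (rnorm g p (T p) * t) + lam i p * C c (rnorm g p (T p) * t)) /
               (C c (rnorm g p (T p) * t)
                  - lam i p * inverse (rnorm g p (T p)) * S c (rnorm g p (T p) * t)))) \<and>
         principal_curvature_along \<A> c (parallel g c f \<eta> T \<nu> t) (parallel_normal g c f \<eta> T \<nu> t)
           p (X (CARD('n)) p)
           (lam (CARD('n)) p / (1 - t * lam (CARD('n)) p))"
proof -
  \<comment> \<open>That \<open>T\<close> vanishes nowhere is contained in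
    \<open>principal_direction\<close>, whose eigenvectors are nonzero.\<close>
  interpret hypersurface_QxR c \<A> g f \<eta> T \<nu>
    using assms by unfold_locales (auto simp: principal_direction_def principal_curvature_along_def)
  have basis: "adapted_principal_basis \<A> g c f \<eta> T lam p (\<lambda>i. X i p)"
    using assms by (auto simp: adapted_principal_frame_on_def)
  then have curv: "principal_curvature_along \<A> c f \<eta> p (X i p) (lam i p)"
    if "i \<in> {1..CARD('n)}" for i
    using that by (auto simp: adapted_principal_basis_def)
  have n: "CARD('n) \<in> {1..CARD('n)}" by (simp add: Suc_leI)
  have Xn: "X (CARD('n)) p = (1 / r p) *\<^sub>R T p"
    using basis by (auto simp: adapted_principal_basis_def)
  \<comment> \<open>By \<open>Xn\<close> the last basis vector is a positive multiple of
    \<open>T p\<close>, so orthonormality of the basis suffices.\<close>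
  have orth: "g p (X i p) (T p) = 0" if i: "i \<in> {1..CARD('n)}" "i \<noteq> CARD('n)" for i
  proof -
    have "bilinear (g p)"
      using metric by (auto simp: riemannian_metric_def)
    moreover have "g p (X i p) (X (CARD('n)) p) = 0"
      using basis i n unfolding adapted_principal_basis_def by metis
    ultimately show ?thesis
      using r_positive[of p] by (simp add: Xn bilinear_rmul)
  qed
  show ?thesis
    using principal_curvature_orthogonal[OF assms(13) curv orth]
      principal_curvature_T[OF assms(13) curv[OF n] Xn] by auto
qed

end
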